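(* Let $A=(a_{ij})\in M_R$ be a reciprocal pairwise comparison matrix of order $n$, let $b>1$ be real, and let $A^{b}$ denote the matrix with entries $a_{ij}^{b}$. Then $KII(A^{b})\ge KII(A)$.
   Context: $M_R$ is the set of all real $n\times n$ matrices $A=(a_{ij})$ with $a_{ij}>0$ for all $i,j$ and $a_{ij}=1/a_{ji}$ for all $i,j$ (reciprocal matrices). The power $A^b=(a_{ij}^b)$ is taken entrywise. Koczkodaj's inconsistency index of $A\in M_R$ is $$KII(A)=\max_{i,j,k\in\{1,\dots,n\}}\ \min\left(\left|1-\frac{a_{ik}}{a_{ij}a_{jk}}\right|,\ \left|1-\frac{a_{ij}a_{jk}}{a_{ik}}\right|\right).$$ *)

theory Defs
  imports "HOL-Analysis.Analysis"
begin

definition reciprocal_matrices :: "(real ^ 'n ^ 'n) set" where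
  "reciprocal_matrices =
     {A. (\<forall>i j. A $ i $ j > 0) \<and> (\<forall>i j. A $ i $ j = 1 / A $ j $ i)}"

text \<open>Entrywise real power, not a power with respect to the matrix product.\<close>

definition entrywise_powr :: "real ^ 'n ^ 'm \<Rightarrow> real \<Rightarrow> real ^ 'n ^ 'm" where
  "entrywise_powr A b = (\<chi> i j. (A $ i $ j) powr b)"

text \<open>Koczkodaj's inconsistency index. The maximum ranges over all triples of indices,
  which need not be distinct, so it is a maximum over a finite nonempty set for every order.\<close>

definition KII :: "real ^ 'n ^ 'n \<Rightarrow> real" where
  "KII A = (MAX (i, j, k) \<in> UNIV.
     min \<bar>1 - A $ i $ k / (A $ i $ j * A $ j $ k)\<bar>
         \<bar>1 - (A $ i $ j * A $ j $ k) / A $ i $ k\<bar>)"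

end

theory Submission
  imports Defs
begin

text \<open>For a triple (i, j, k) let y be the ratio of a_ik to a_ij * a_jk, a positive number.
  Since powers are multiplicative, passing to the entrywise power replaces y by y^b and 1/y by
  (1/y)^b. An exponent above 1 moves every positive number away from 1, or fixes it at 1
  (\<open>abs_one_minus_le_powr\<close>), so both terms under the minimum can only grow. Minimum and
  maximum preserve such termwise bounds (\<open>Max_image_mono\<close>).\<close>

text \<open>The power stays on the same side of 1 as y: 1 \<le> y \<le> y^b in one case, y^b \<le> y
  < 1 in the other.\<close>

lemma abs_one_minus_le_powr:
  fixes y b :: real
  assumes "y > 0" "b \<ge> 1"
  shows "\<bar>1 - y\<bar> \<le> \<bar>1 - y powr b\<bar>"
proof (cases "y \<ge> 1")
  case True
  then have "y powr 1 \<le> y powr b"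
    using assms by (intro powr_mono) auto
  with True show ?thesis by simp
next
  case False
  then have "y powr b \<le> y powr 1"
    using assms by (intro powr_mono') auto
  with False assms show ?thesis by simp
qed

lemma Max_image_mono:
  fixes f g :: "'a \<Rightarrow> 'b::linorder"
  assumes "finite S" "S \<noteq> {}" "\<And>x. x \<in> S \<Longrightarrow> f x \<le> g x"
  shows "Max (f ` S) \<le> Max (g ` S)"
proof (rule Max.boundedI)
  fix y assume "y \<in> f ` S"
  then obtain x where x: "x \<in> S" "y = f x" by blast
  then have "y \<le> g x" using assms(3) by simp
  also have "g x \<le> Max (g ` S)" using assms(1) x(1) by (intro Max_ge) simp_all
  finally show "y \<le> Max (g ` S)" .
qed (simp_all add: assms(1,2))

theorem proposition14:
  fixes A :: "real ^ 'n ^ 'n" and b :: real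
  assumes "A \<in> reciprocal_matrices" and "b > 1"
  shows "KII (entrywise_powr A b) \<ge> KII A"
proof -
  have pos: "A $ i $ j > 0" for i j
    using assms(1) unfolding reciprocal_matrices_def by blast
  \<comment> \<open>The right-hand side is the power of the whole ratio, distributed over its
    positive factors to match the entries of the powered matrix.\<close>
  have ratio: "\<bar>1 - A $ i $ k / (A $ i $ j * A $ j $ k)\<bar>
      \<le> \<bar>1 - (A $ i $ k) powr b / ((A $ i $ j) powr b * (A $ j $ k) powr b)\<bar>" for i j k
    using abs_one_minus_le_powr[of "A $ i $ k / (A $ i $ j * A $ j $ k)" b] assms(2)
    by (simp add: pos powr_divide powr_mult)
  have inverse_ratio: "\<bar>1 - (A $ i $ j * A $ j $ k) / A $ i $ k\<bar>
      \<le> \<bar>1 - ((A $ i $ j) powr b * (A $ j $ k) powr b) / (A $ i $ k) powr b\<bar>" for i j k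
    using abs_one_minus_le_powr[of "(A $ i $ j * A $ j $ k) / A $ i $ k" b] assms(2)
    by (simp add: pos powr_divide powr_mult)
  show ?thesis
    unfolding KII_def entrywise_powr_def
  proof (rule Max_image_mono, goal_cases)
    \<comment> \<open>Goals 1 and 2 say that the set of index triples is finite and nonempty; goal 3
      is the bound for a single triple.\<close>
    case (3 x)
    obtain i j k where "x = (i, j, k)" by (cases x)
    then show ?case
      by (simp only: prod.case vec_lambda_beta) (intro min.mono ratio inverse_ratio)
  qed simp_all
qed

end
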